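(* Let $n\ge 1$, let $X_1,\ldots,X_n$ be nonnegative integrable real random variables, and let $\tilde X_1,\ldots,\tilde X_n$ be mutually independent random variables such that each $\tilde X_i$ has the same distribution as $X_i$. Suppose that for all $i\ne j$ in $\{1,\ldots,n\}$ and all $t>0$, $$\mathbb{P}(X_i>t,\,X_j>t)\ \le\ \mathbb{P}(X_i>t)\,\mathbb{P}(X_j>t).$$ Then $$\mathbb{E}\max_{1\le i\le n}X_i\ \ge\ \frac12\,\mathbb{E}\max_{1\le i\le n}\tilde X_i.$$ *)

theory Defs
  imports "HOL-Probability.Probability"
begin

end

theory Submission
  imports Defs
begin

text \<open>For \<open>t > 0\<close> put \<open>s = (\<Sum>i. P (X\<^sub>i > t))\<close>. The second moment bound
  (Chung--Erdos) together with pairwise negative correlation gives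
  \<open>P (max X\<^sub>i > t) \<ge> s / (1 + s) \<ge> min 1 s / 2\<close>, while the union bound gives
  \<open>P (max Y\<^sub>i > t) \<le> min 1 s\<close>. Integrating over \<open>t\<close> compares the expectations.\<close>

text \<open>Let \<open>K\<close> count the indices whose event occurs. Its mean is \<open>s\<close>,
  and negative correlation keeps its second moment below that of the uncorrelated case plus slack,
  at most \<open>s\<^sup>2 + s\<close>. Cauchy-Schwarz would then give the ratio of the squared mean
  to the second moment. Bounding the indicator of the union below by a quadratic in \<open>K\<close>
  gives the same value and treats \<open>s = 0\<close> uniformly.\<close>

lemma (in prob_space) prob_Union_ge_of_pairwise_neg_corr:
  assumes fin: "finite I"
    and A: "\<And>i. i \<in> I \<Longrightarrow> A i \<in> events"
    and neg: "\<And>i j. i \<in> I \<Longrightarrow> j \<in> I \<Longrightarrow> i \<noteq> j \<Longrightarrow> prob (A i \<inter> A j) \<le> prob (A i) * prob (A j)"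
  defines "s \<equiv> \<Sum>i\<in>I. prob (A i)"
  shows "s / (1 + s) \<le> prob (\<Union>i\<in>I. A i)"
proof -
  define K :: "'a \<Rightarrow> real" where "K = (\<lambda>\<omega>. \<Sum>i\<in>I. indicator (A i) \<omega>)"
  define c where "c = 1 / (1 + s)"
  have s0: "0 \<le> s" unfolding s_def by (simp add: sum_nonneg)
  have U: "(\<Union>i\<in>I. A i) \<in> events" using fin A by auto
  have K2: "(K \<omega>)\<^sup>2 = (\<Sum>i\<in>I. \<Sum>j\<in>I. indicator (A i \<inter> A j) \<omega>)" for \<omega>
    by (simp add: K_def power2_eq_square sum_product indicator_inter_arith)
  have intA: "integrable M (indicator B :: 'a \<Rightarrow> real)" if "B \<in> events" for B
    using that by (simp add: integrable_indicator_iff emeasure_eq_measure)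
  have AA: "A i \<inter> A j \<in> events" if "i \<in> I" "j \<in> I" for i j using A that by auto
  have intK: "integrable M K" unfolding K_def using A intA by (intro Bochner_Integration.integrable_sum) auto
  have intK2: "integrable M (\<lambda>\<omega>. (K \<omega>)\<^sup>2)" unfolding K2
    using AA intA by (intro Bochner_Integration.integrable_sum) auto
  have EK: "expectation K = s"
    unfolding K_def s_def using A intA by (subst Bochner_Integration.integral_sum) auto
  have "expectation (\<lambda>\<omega>. (K \<omega>)\<^sup>2) = (\<Sum>i\<in>I. \<Sum>j\<in>I. prob (A i \<inter> A j))"
    unfolding K2 using AA intA by (simp add: Bochner_Integration.integral_sum)
  \<comment> \<open>Negative correlation only speaks of distinct indices. A diagonal term is
    \<open>prob (A i)\<close> itself, so the conditional summand pays for it; these summands add up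
    to the linear term \<open>s\<close>.\<close>
  also have "\<dots> \<le> (\<Sum>i\<in>I. \<Sum>j\<in>I. prob (A i) * prob (A j) + (if i = j then prob (A i) else 0))"
    by (intro sum_mono) (use neg in auto)
  also have "\<dots> = s\<^sup>2 + s"
    using fin by (simp add: sum.distrib s_def power2_eq_square sum_product)
  finally have EK2: "expectation (\<lambda>\<omega>. (K \<omega>)\<^sup>2) \<le> s\<^sup>2 + s" .
  \<comment> \<open>The pointwise bound is \<open>1 - (1 - c K)\<^sup>2 \<le> 1\<close> on the union, and \<open>K = 0\<close> off it;
    this value of \<open>c\<close> optimises the resulting estimate.\<close>
  have pt: "2 * c * K \<omega> - c\<^sup>2 * (K \<omega>)\<^sup>2 \<le> indicator (\<Union>i\<in>I. A i) \<omega>" for \<omega>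
  proof (cases "\<omega> \<in> (\<Union>i\<in>I. A i)")
    case True
    have "0 \<le> (1 - c * K \<omega>)\<^sup>2" by simp
    then show ?thesis using True by (simp add: power2_eq_square algebra_simps)
  next
    case False
    then have "K \<omega> = 0" by (auto simp: K_def intro!: sum.neutral)
    then show ?thesis by simp
  qed
  \<comment> \<open>Since \<open>c * (1 + s) = 1\<close>, the subtracted term equals
    \<open>c * s\<close>, which leaves \<open>c * s\<close>.\<close>
  have "s / (1 + s) = 2 * c * s - c\<^sup>2 * (s\<^sup>2 + s)"
    using s0 by (simp add: c_def divide_simps power2_eq_square) (simp add: algebra_simps)
  also have "\<dots> \<le> 2 * c * s - c\<^sup>2 * expectation (\<lambda>\<omega>. (K \<omega>)\<^sup>2)"
    using EK2 by (simp add: mult_left_mono)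
  also have "\<dots> = expectation (\<lambda>\<omega>. 2 * c * K \<omega> - c\<^sup>2 * (K \<omega>)\<^sup>2)"
    using intK intK2 EK by simp
  also have "\<dots> \<le> expectation (indicator (\<Union>i\<in>I. A i))"
    using intK intK2 intA[OF U] pt by (intro integral_mono) auto
  also have "\<dots> = prob (\<Union>i\<in>I. A i)" using U by simp
  finally show ?thesis .
qed

text \<open>A nonnegative value is the length of the interval from 0 to it, so Tonelli's theorem on
  the region below the graph exchanges the two integrals. Where \<open>f\<close> is negative,
  \<open>ennreal\<close> gives 0 and the interval is empty, so both sides see only the positive
  part.\<close>

lemma (in sigma_finite_measure) nn_integral_layer_cake:
  fixes f :: "'a \<Rightarrow> real"
  assumes [measurable]: "f \<in> borel_measurable M"
  shows "(\<integral>\<^sup>+\<omega>. ennreal (f \<omega>) \<partial>M)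
    = (\<integral>\<^sup>+t. indicator {0<..} t * emeasure M {\<omega>\<in>space M. t < f \<omega>} \<partial>lborel)"
proof -
  interpret P: pair_sigma_finite lborel M ..
  have "(\<integral>\<^sup>+\<omega>. ennreal (f \<omega>) \<partial>M) = (\<integral>\<^sup>+\<omega>. (\<integral>\<^sup>+t. indicator {0<..<f \<omega>} t \<partial>lborel) \<partial>M)"
  proof (intro nn_integral_cong)
    fix \<omega>
    show "ennreal (f \<omega>) = (\<integral>\<^sup>+t. indicator {0<..<f \<omega>} t \<partial>lborel)"
      by (cases "0 \<le> f \<omega>") (simp_all add: ennreal_neg)
  qed
  also have "\<dots> = (\<integral>\<^sup>+\<omega>. (\<integral>\<^sup>+t. indicator {(t, \<omega>). 0 < t \<and> t < f \<omega>} (t, \<omega>) \<partial>lborel) \<partial>M)"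
    by (intro nn_integral_cong) (auto split: split_indicator)
  also have "\<dots> = (\<integral>\<^sup>+t. (\<integral>\<^sup>+\<omega>. indicator {(t, \<omega>). 0 < t \<and> t < f \<omega>} (t, \<omega>) \<partial>M) \<partial>lborel)"
    by (rule P.Fubini') measurable
  also have "\<dots> = (\<integral>\<^sup>+t. (\<integral>\<^sup>+\<omega>. indicator {0<..} t * indicator {\<omega>\<in>space M. t < f \<omega>} \<omega> \<partial>M) \<partial>lborel)"
    by (intro nn_integral_cong) (auto split: split_indicator)
  also have "\<dots> = (\<integral>\<^sup>+t. indicator {0<..} t * emeasure M {\<omega>\<in>space M. t < f \<omega>} \<partial>lborel)"
    by (intro nn_integral_cong) (simp add: nn_integral_cmult)
  finally show ?thesis .
qed

lemma integrable_Max: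
  fixes f :: "'i \<Rightarrow> 'a \<Rightarrow> real"
  assumes "finite I" "I \<noteq> {}" and int: "\<And>i. i \<in> I \<Longrightarrow> integrable M (f i)"
  shows "integrable M (\<lambda>\<omega>. Max ((\<lambda>i. f i \<omega>) ` I))"
  using assms
proof (induction rule: finite_ne_induct)
  case (insert i I)
  then show ?case by simp
qed simp

theorem mainTheorem4:
  fixes M :: "'a measure" and N :: "'b measure"
    and X :: "nat \<Rightarrow> 'a \<Rightarrow> real" and Y :: "nat \<Rightarrow> 'b \<Rightarrow> real"
    and n :: nat
  assumes "n \<ge> 1"
    and "prob_space M" and "prob_space N"
    and "\<And>i. i \<in> {1..n} \<Longrightarrow> integrable M (X i)"
    and "\<And>i. i \<in> {1..n} \<Longrightarrow> AE \<omega> in M. X i \<omega> \<ge> 0"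
    and "prob_space.indep_vars N (\<lambda>_. borel) Y {1..n}"
    and "\<And>i. i \<in> {1..n} \<Longrightarrow> distr N borel (Y i) = distr M borel (X i)"
    and "\<And>i j t. i \<in> {1..n} \<Longrightarrow> j \<in> {1..n} \<Longrightarrow> i \<noteq> j \<Longrightarrow> t > 0 \<Longrightarrow>
           \<P>(\<omega> in M. X i \<omega> > t \<and> X j \<omega> > t)
             \<le> \<P>(\<omega> in M. X i \<omega> > t) * \<P>(\<omega> in M. X j \<omega> > t)"
  shows "prob_space.expectation M (\<lambda>\<omega>. Max ((\<lambda>i. X i \<omega>) ` {1..n}))
           \<ge> 1 / 2 * prob_space.expectation N (\<lambda>\<omega>. Max ((\<lambda>i. Y i \<omega>) ` {1..n}))"
proof -
  interpret M: prob_space M by fact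
  interpret N: prob_space N by fact
  define I where "I = {1..n}"
  define f where "f = (\<lambda>\<omega>. Max ((\<lambda>i. X i \<omega>) ` I))"
  define g where "g = (\<lambda>\<omega>. Max ((\<lambda>i. Y i \<omega>) ` I))"
  have I: "finite I" "I \<noteq> {}" using assms(1) by (auto simp: I_def)
  have intX: "integrable M (X i)" if "i \<in> I" for i using assms(4) that by (simp add: I_def)
  have X[measurable]: "X i \<in> borel_measurable M" if "i \<in> I" for i using intX[OF that] by simp
  have Y[measurable]: "Y i \<in> borel_measurable N" if "i \<in> I" for i
    using assms(6) that unfolding N.indep_vars_def I_def by auto
  have distr: "distr N borel (Y i) = distr M borel (X i)" if "i \<in> I" for i
    using assms(7) that by (simp add: I_def)
  \<comment> \<open>Integrability and almost sure nonnegativity depend only on the law, so both pass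
    from \<open>X i\<close> to \<open>Y i\<close> through the common image measure on the
    reals.\<close>
  have intY: "integrable N (Y i)" if "i \<in> I" for i
  proof -
    have "integrable (distr M borel (X i)) (\<lambda>x. x)" using intX that by (simp add: integrable_distr_eq)
    then show ?thesis unfolding distr[OF that, symmetric] using that by (simp add: integrable_distr_eq)
  qed
  have posX: "AE \<omega> in M. X i \<omega> \<ge> 0" if "i \<in> I" for i using assms(5) that by (simp add: I_def)
  have posY: "AE \<omega> in N. Y i \<omega> \<ge> 0" if "i \<in> I" for i
  proof -
    have "AE x in distr M borel (X i). x \<ge> 0" using posX that by (simp add: AE_distr_iff)
    then show ?thesis unfolding distr[OF that, symmetric] using that by (simp add: AE_distr_iff)
  qed
  have intf: "integrable M f" unfolding f_def using I intX by (rule integrable_Max)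
  have intg: "integrable N g" unfolding g_def using I intY by (rule integrable_Max)
  \<comment> \<open>A maximum dominates each of its terms, so the sign of one term settles the sign
    of the maximum.\<close>
  obtain k where k: "k \<in> I" using I by blast
  have posf: "AE \<omega> in M. f \<omega> \<ge> 0"
    using posX[OF k] by eventually_elim (use I k in \<open>auto simp: f_def Max_ge_iff\<close>)
  have posg: "AE \<omega> in N. g \<omega> \<ge> 0"
    using posY[OF k] by eventually_elim (use I k in \<open>auto simp: g_def Max_ge_iff\<close>)
  \<comment> \<open>The comparison is made one level \<open>t\<close> at a time: a maximum exceeds
    \<open>t\<close> exactly when some variable does, so both tails are probabilities of unions with
    the same individual probabilities. The factor 2 of the theorem arises here.\<close>
  have tail: "N.prob {\<omega>\<in>space N. t < g \<omega>} \<le> 2 * M.prob {\<omega>\<in>space M. t < f \<omega>}" if t: "t > 0" for t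
  proof -
    define A where "A = (\<lambda>i. {\<omega>\<in>space M. t < X i \<omega>})"
    define B where "B = (\<lambda>i. {\<omega>\<in>space N. t < Y i \<omega>})"
    define s where "s = (\<Sum>i\<in>I. M.prob (A i))"
    have A: "A i \<in> M.events" if "i \<in> I" for i using that X unfolding A_def by measurable
    have B: "B i \<in> N.events" if "i \<in> I" for i using that Y unfolding B_def by measurable
    have AB: "N.prob (B i) = M.prob (A i)" if "i \<in> I" for i
    proof -
      have "N.prob (B i) = measure (distr N borel (Y i)) {t<..}"
        using that by (auto simp: measure_distr B_def intro!: arg_cong[where f = N.prob])
      also have "\<dots> = M.prob (A i)" unfolding distr[OF that]
        using that by (auto simp: measure_distr A_def intro!: arg_cong[where f = M.prob])
      finally show ?thesis .
    qed
    have fA: "{\<omega>\<in>space M. t < f \<omega>} = (\<Union>i\<in>I. A i)"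
      using I by (auto simp: f_def A_def Max_gr_iff)
    have gB: "{\<omega>\<in>space N. t < g \<omega>} = (\<Union>i\<in>I. B i)"
      using I by (auto simp: g_def B_def Max_gr_iff)
    have s0: "0 \<le> s" by (simp add: s_def sum_nonneg)
    have neg: "M.prob (A i \<inter> A j) \<le> M.prob (A i) * M.prob (A j)" if "i \<in> I" "j \<in> I" "i \<noteq> j" for i j
    proof -
      have "A i \<inter> A j = {\<omega>\<in>space M. X i \<omega> > t \<and> X j \<omega> > t}" by (auto simp: A_def)
      then show ?thesis using assms(8)[of i j t] that t by (simp add: A_def I_def)
    qed
    have lower: "s / (1 + s) \<le> M.prob (\<Union>i\<in>I. A i)"
      unfolding s_def by (rule M.prob_Union_ge_of_pairwise_neg_corr[OF I(1) A neg])
    have "N.prob (\<Union>i\<in>I. B i) \<le> (\<Sum>i\<in>I. N.prob (B i))"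
      using I B by (intro N.finite_measure_subadditive_finite) auto
    also have "\<dots> = s" unfolding s_def using AB by simp
    finally have "N.prob (\<Union>i\<in>I. B i) \<le> min 1 s" by simp
    \<comment> \<open>For \<open>s \<le> 1\<close> this reduces to \<open>s * s \<le> s\<close>; for
      larger \<open>s\<close> the right side exceeds 1. Equality at \<open>s = 1\<close> shows that
      2 is the best constant for this comparison.\<close>
    also have "min 1 s \<le> 2 * (s / (1 + s))"
    proof (cases "s \<le> 1")
      case True
      have "s * s \<le> s * 1" using True s0 by (intro mult_left_mono)
      then show ?thesis using True s0 by (simp add: field_simps)
    next
      case False
      then show ?thesis by (simp add: field_simps)
    qed
    finally show ?thesis using lower unfolding fA gB by simp
  qed
  have "(\<integral>\<^sup>+\<omega>. ennreal (g \<omega>) \<partial>N)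
      = (\<integral>\<^sup>+t. indicator {0<..} t * emeasure N {\<omega>\<in>space N. t < g \<omega>} \<partial>lborel)"
    using intg by (intro N.nn_integral_layer_cake) simp
  also have "\<dots> \<le> (\<integral>\<^sup>+t. 2 * (indicator {0<..} t * emeasure M {\<omega>\<in>space M. t < f \<omega>}) \<partial>lborel)"
  proof (intro nn_integral_mono)
    fix t :: real
    show "indicator {0<..} t * emeasure N {\<omega>\<in>space N. t < g \<omega>}
        \<le> 2 * (indicator {0<..} t * emeasure M {\<omega>\<in>space M. t < f \<omega>})"
    proof (cases "t > 0")
      case True
      have "ennreal (N.prob {\<omega>\<in>space N. t < g \<omega>}) \<le> ennreal (2 * M.prob {\<omega>\<in>space M. t < f \<omega>})"
        by (rule ennreal_leI) (rule tail[OF True])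
      then show ?thesis
        using True by (simp add: M.emeasure_eq_measure N.emeasure_eq_measure ennreal_mult)
    qed simp
  qed
  also have "\<dots> = 2 * (\<integral>\<^sup>+t. indicator {0<..} t * emeasure M {\<omega>\<in>space M. t < f \<omega>} \<partial>lborel)"
  proof (rule nn_integral_cmult)
    have [measurable]: "f \<in> borel_measurable M" using intf by simp
    show "(\<lambda>t. indicator {0<..} t * emeasure M {\<omega>\<in>space M. t < f \<omega>}) \<in> borel_measurable lborel"
      by measurable
  qed
  also have "\<dots> = 2 * (\<integral>\<^sup>+\<omega>. ennreal (f \<omega>) \<partial>M)"
    using intf by (subst M.nn_integral_layer_cake) simp_all
  finally have "(\<integral>\<^sup>+\<omega>. ennreal (g \<omega>) \<partial>N) \<le> 2 * (\<integral>\<^sup>+\<omega>. ennreal (f \<omega>) \<partial>M)" .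
  then have "ennreal (N.expectation g) \<le> ennreal (2 * M.expectation f)"
    using intf intg posf posg by (simp add: nn_integral_eq_integral ennreal_mult integral_nonneg_AE)
  \<comment> \<open>As \<open>ennreal\<close> collapses negative reals to 0, returning to the reals
    requires a nonnegative right side, which \<open>posf\<close> supplies.\<close>
  then have "N.expectation g \<le> 2 * M.expectation f"
    using posf by (subst (asm) ennreal_le_iff) (auto intro: integral_nonneg_AE)
  then show ?thesis by (simp add: f_def g_def I_def)
qed

end
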